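(* Let $(A,\to)$ be a probabilistic abstract rewrite system and $(\mathrm{m}A,\Rightarrow)$ the induced rewrite system on multidistributions. Suppose that it satisfies at least one of the following three properties, where $\Rightarrow^*$ is the reflexive–transitive closure of $\Rightarrow$: (i) Confluence: for all $\mathrm{m},\mathrm{s},\mathrm{r}\in \mathrm{m}A$ with $\mathrm{m}\Rightarrow^*\mathrm{s}$ and $\mathrm{m}\Rightarrow^*\mathrm{r}$ there is $\mathrm{u}$ with $\mathrm{s}\Rightarrow^*\mathrm{u}$ and $\mathrm{r}\Rightarrow^*\mathrm{u}$; (ii) $\mathrm{nf}$-confluence: for all $\mathrm{m},\mathrm{s},\mathrm{r}$ with $\mathrm{m}\Rightarrow^*\mathrm{s}$ and $\mathrm{m}\Rightarrow^*\mathrm{r}$ there are $\mathrm{s}',\mathrm{r}'$ with $\mathrm{s}\Rightarrow^*\mathrm{s}'$, $\mathrm{r}\Rightarrow^*\mathrm{r}'$ and $\mathrm{nf}(\mathrm{s}')=\mathrm{nf}(\mathrm{r}')$; (iii) Skew-confluence: for all $\mathrm{m},\mathrm{s},\mathrm{r}$ with $\mathrm{m}\Rightarrow^*\mathrm{s}$ and $\mathrm{m}\Rightarrow^*\mathrm{r}$ there is $\mathrm{s}'$ with $\mathrm{s}\Rightarrow^*\mathrm{s}'$ and $\mathrm{nf}(\mathrm{r})\le \mathrm{nf}(\mathrm{s}')$. Then for every $\mathrm{m}\in\mathrm{m}A$ the set $\mathrm{Lim}(\mathrm{m})$ has a greatest element (with respect to the pointwise order on subdistributions).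
   Context: A subdistribution on a countable set $X$ is a map $\mu:X\to[0,1]$ with $\sum_{x}\mu(x)\le 1$; subdistributions are ordered pointwise. A probabilistic abstract rewrite system is a pair $(A,\to)$ with $A$ countable and $\to\subseteq A\times\mathcal D^{fin}(A)$ (finitely supported subdistributions), such that $a\to\beta$ implies $\sum\beta=1$. We write $\beta=\{a_k^{p_k}\mid k\in K\}$ for the distribution with $\beta(a_k)=p_k$. An element $a$ is a normal form if there is no $\beta$ with $a\to\beta$; $\mathrm{NF}_A$ is the set of normal forms. A multidistribution is a finite multiset $\mathrm{m}=[p_ia_i\mid i\in I]$ of pairs with $p_i\in(0,1]$, $a_i\in A$, $\sum_i p_i\le 1$; $\mathrm{m}A$ is the set of multidistributions, $[a]$ denotes $[1a]$, $+$ is multiset union and $q\cdot[p_ia_i\mid i\in I]=[(qp_i)a_i\mid i\in I]$. The relation $\Rightarrow\subseteq \mathrm{m}A\times\mathrm{m}A$ is the least relation such that: (L1) $[a]\Rightarrow[a]$ if $a$ is a normal form; (L2) $[a]\Rightarrow[p_ka_k\mid k\in K]$ whenever $a\to\{a_k^{p_k}\mid k\in K\}$; (L3) if $[a_i]\Rightarrow\mathrm{m}_i$ for every $i\in I$ then $[p_ia_i\mid i\in I]\Rightarrow\sum_{i\in I}p_i\cdot\mathrm{m}_i$. For $\mathrm{m}=[p_ia_i\mid i\in I]$, $\mathrm{nf}(\mathrm{m})$ is the subdistribution on $\mathrm{NF}_A$ given by $\mathrm{nf}(\mathrm{m})(u)=\sum_{i:\,a_i=u}p_i$. A $\Rightarrow$-sequence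 from $\mathrm{m}$ is an infinite sequence $\mathrm{m}=\mathrm{m}_0\Rightarrow\mathrm{m}_1\Rightarrow\cdots$; it converges to the subdistribution $\beta$ on $\mathrm{NF}_A$ defined by $\beta(u)=\sup_n\mathrm{nf}(\mathrm{m}_n)(u)$. $\mathrm{Lim}(\mathrm{m})$ is the set of all $\beta$ such that some $\Rightarrow$-sequence from $\mathrm{m}$ converges to $\beta$. *)

theory Defs
  imports "HOL-Analysis.Analysis" "HOL-Library.Multiset"
begin

text \<open>A function on \<open>X\<close> is represented by its extension by \<open>0\<close> to the whole type. Hence the pointwise
  order on subdistributions is the order \<open>\<le>\<close> of the function type, and a subdistribution on a
  subset of \<open>X\<close> is also one on \<open>X\<close>.\<close>

definition subdistribution :: "'a set \<Rightarrow> ('a \<Rightarrow> real) \<Rightarrow> bool" where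
  "subdistribution X \<mu> \<longleftrightarrow>
     (\<forall>x\<in>X. 0 \<le> \<mu> x \<and> \<mu> x \<le> 1) \<and> (\<forall>x. x \<notin> X \<longrightarrow> \<mu> x = 0) \<and>
     \<mu> summable_on X \<and> infsum \<mu> X \<le> 1"

definition fin_subdistributions :: "'a set \<Rightarrow> ('a \<Rightarrow> real) set" where
  "fin_subdistributions X = {\<mu>. subdistribution X \<mu> \<and> finite {x\<in>X. \<mu> x \<noteq> 0}}"

definition pars :: "'a set \<Rightarrow> ('a \<times> ('a \<Rightarrow> real)) set \<Rightarrow> bool" where
  "pars A R \<longleftrightarrow> countable A \<and> R \<subseteq> A \<times> fin_subdistributions A \<and>
     (\<forall>(a, \<beta>)\<in>R. infsum \<beta> A = 1)"

definition NF :: "'a set \<Rightarrow> ('a \<times> ('a \<Rightarrow> real)) set \<Rightarrow> 'a set" where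
  "NF A R = {a\<in>A. \<nexists>\<beta>. (a, \<beta>) \<in> R}"

type_synonym 'a mdist = "(real \<times> 'a) multiset"

definition multidistributions :: "'a set \<Rightarrow> 'a mdist set" where
  "multidistributions A =
     {m. (\<forall>(p, a)\<in>#m. 0 < p \<and> p \<le> 1 \<and> a \<in> A) \<and> (\<Sum>(p, a)\<in>#m. p) \<le> 1}"

definition scale :: "real \<Rightarrow> 'a mdist \<Rightarrow> 'a mdist" where
  "scale q m = image_mset (\<lambda>(p, a). (q * p, a)) m"

text \<open>In \<open>{a\<^sub>k\<^sup>p\<^sup>k | k \<in> K}\<close> the \<open>a\<^sub>k\<close> are pairwise distinct and, since pairs of
  weight \<open>0\<close> do not occur in multidistributions, they enumerate the support.\<close>

definition mdist_of :: "'a set \<Rightarrow> ('a \<Rightarrow> real) \<Rightarrow> 'a mdist" where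
  "mdist_of A \<beta> = image_mset (\<lambda>a. (\<beta> a, a)) (mset_set {a\<in>A. \<beta> a \<noteq> 0})"

text \<open>In rule \<open>L3\<close>, index sets of type \<open>nat set\<close> suffice because \<open>I\<close> is finite.\<close>

inductive mstep :: "'a set \<Rightarrow> ('a \<times> ('a \<Rightarrow> real)) set \<Rightarrow> 'a mdist \<Rightarrow> 'a mdist \<Rightarrow> bool"
  for A :: "'a set" and R :: "('a \<times> ('a \<Rightarrow> real)) set" where
  L1: "a \<in> NF A R \<Longrightarrow> mstep A R {#(1, a)#} {#(1, a)#}"
| L2: "(a, \<beta>) \<in> R \<Longrightarrow> mstep A R {#(1, a)#} (mdist_of A \<beta>)"
| L3: "\<lbrakk>finite (I :: nat set); {#(p i, a i). i \<in># mset_set I#} \<in> multidistributions A;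
        \<And>i. i \<in> I \<Longrightarrow> mstep A R {#(1, a i)#} (m i)\<rbrakk>
       \<Longrightarrow> mstep A R {#(p i, a i). i \<in># mset_set I#} (\<Sum>i\<in>I. scale (p i) (m i))"

abbreviation msteps :: "'a set \<Rightarrow> ('a \<times> ('a \<Rightarrow> real)) set \<Rightarrow> 'a mdist \<Rightarrow> 'a mdist \<Rightarrow> bool" where
  "msteps A R \<equiv> (mstep A R)\<^sup>*\<^sup>*"

definition nf :: "'a set \<Rightarrow> ('a \<times> ('a \<Rightarrow> real)) set \<Rightarrow> 'a mdist \<Rightarrow> 'a \<Rightarrow> real" where
  "nf A R m u = (if u \<in> NF A R then (\<Sum>x\<in>#{#x \<in># m. snd x = u#}. fst x) else 0)"

definition mstep_sequence ::
  "'a set \<Rightarrow> ('a \<times> ('a \<Rightarrow> real)) set \<Rightarrow> 'a mdist \<Rightarrow> (nat \<Rightarrow> 'a mdist) \<Rightarrow> bool" where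
  "mstep_sequence A R m s \<longleftrightarrow> s 0 = m \<and> (\<forall>n. mstep A R (s n) (s (Suc n)))"

definition seq_limit ::
  "'a set \<Rightarrow> ('a \<times> ('a \<Rightarrow> real)) set \<Rightarrow> (nat \<Rightarrow> 'a mdist) \<Rightarrow> 'a \<Rightarrow> real" where
  "seq_limit A R s u = (SUP n. nf A R (s n) u)"

definition Lim_set ::
  "'a set \<Rightarrow> ('a \<times> ('a \<Rightarrow> real)) set \<Rightarrow> 'a mdist \<Rightarrow> ('a \<Rightarrow> real) set" where
  "Lim_set A R m = {\<beta>. \<exists>s. mstep_sequence A R m s \<and> \<beta> = seq_limit A R s}"

definition confluent :: "'a set \<Rightarrow> ('a \<times> ('a \<Rightarrow> real)) set \<Rightarrow> bool" where
  "confluent A R \<longleftrightarrow>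
     (\<forall>m\<in>multidistributions A. \<forall>s\<in>multidistributions A. \<forall>r\<in>multidistributions A.
        msteps A R m s \<and> msteps A R m r \<longrightarrow>
        (\<exists>u\<in>multidistributions A. msteps A R s u \<and> msteps A R r u))"

definition nf_confluent :: "'a set \<Rightarrow> ('a \<times> ('a \<Rightarrow> real)) set \<Rightarrow> bool" where
  "nf_confluent A R \<longleftrightarrow>
     (\<forall>m\<in>multidistributions A. \<forall>s\<in>multidistributions A. \<forall>r\<in>multidistributions A.
        msteps A R m s \<and> msteps A R m r \<longrightarrow>
        (\<exists>s'\<in>multidistributions A. \<exists>r'\<in>multidistributions A.
           msteps A R s s' \<and> msteps A R r r' \<and> nf A R s' = nf A R r'))"

definition skew_confluent :: "'a set \<Rightarrow> ('a \<times> ('a \<Rightarrow> real)) set \<Rightarrow> bool" where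
  "skew_confluent A R \<longleftrightarrow>
     (\<forall>m\<in>multidistributions A. \<forall>s\<in>multidistributions A. \<forall>r\<in>multidistributions A.
        msteps A R m s \<and> msteps A R m r \<longrightarrow>
        (\<exists>s'\<in>multidistributions A. msteps A R s s' \<and> nf A R r \<le> nf A R s'))"

text \<open>Well-definedness: \<open>mstep\<close> is a relation on multidistributions, and the suprema defining the
  elements of \<open>Lim_set\<close> are suprema of bounded sets and yield subdistributions on \<open>NF A R\<close>.\<close>

lemma mdist_of_multidistribution:
  assumes "pars A R" "(a, \<beta>) \<in> R"
  shows "mdist_of A \<beta> \<in> multidistributions A"
proof -
  let ?S = "{x\<in>A. \<beta> x \<noteq> 0}"
  have *: "subdistribution A \<beta>" "finite ?S"
    using assms by (auto simp: pars_def fin_subdistributions_def)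
  then have **: "0 < \<beta> x \<and> \<beta> x \<le> 1" if "x \<in> ?S" for x
    using that by (auto simp: subdistribution_def less_le)
  have "infsum \<beta> A = infsum \<beta> ?S"
    by (rule infsum_cong_neutral) auto
  then have "sum \<beta> ?S \<le> 1"
    using * by (auto simp: subdistribution_def)
  then show ?thesis
    using * ** by (auto simp: multidistributions_def mdist_of_def sum_unfold_sum_mset
        image_mset.compositionality comp_def)
qed

lemma in_sum_mset: "finite I \<Longrightarrow> x \<in># (\<Sum>i\<in>I. f i) \<longleftrightarrow> (\<exists>i\<in>I. x \<in># f i)"
  by (induction I rule: finite_induct) auto

lemma weight_sum:
  "finite I \<Longrightarrow> (\<Sum>(p, a)\<in>#(\<Sum>i\<in>I. f i). p :: real) = (\<Sum>i\<in>I. \<Sum>(p, a)\<in>#f i. p)"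
  by (induction I rule: finite_induct) auto

lemma weight_scale: "(\<Sum>(p, a)\<in>#scale q m. p) = q * (\<Sum>(p, a)\<in>#m. p)"
  unfolding scale_def by (induction m) (auto simp: algebra_simps)

lemma mstep_multidistributions:
  assumes "pars A R" "mstep A R m n"
  shows "m \<in> multidistributions A \<and> n \<in> multidistributions A"
  using assms(2)
proof induction
  case (L1 a)
  then show ?case by (auto simp: multidistributions_def NF_def)
next
  case (L2 a \<beta>)
  then have "a \<in> A" using assms(1) by (auto simp: pars_def)
  with L2 show ?case using mdist_of_multidistribution[OF assms(1)]
    by (auto simp: multidistributions_def)
next
  case (L3 I p a m)
  have p: "0 < p i \<and> p i \<le> 1" if "i \<in> I" for i
    using L3(1,2) that by (auto simp: multidistributions_def)
  have s: "sum p I \<le> 1"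
    using L3(1,2) by (auto simp: multidistributions_def sum_unfold_sum_mset
        image_mset.compositionality comp_def)
  have m: "(\<Sum>(p, a)\<in>#m i. p) \<le> 1" "\<And>q b. (q, b) \<in># m i \<Longrightarrow> 0 < q \<and> q \<le> 1 \<and> b \<in> A"
    if "i \<in> I" for i
    using L3(4)[OF that] by (auto simp: multidistributions_def)
  have "(\<Sum>i\<in>I. p i * (\<Sum>(p, a)\<in>#m i. p)) \<le> (\<Sum>i\<in>I. p i * 1)"
    using p m(1) by (intro sum_mono mult_left_mono) (auto intro: less_imp_le)
  then have "(\<Sum>(p, a)\<in>#(\<Sum>i\<in>I. scale (p i) (m i)). p) \<le> 1"
    using s L3(1) by (simp add: weight_sum weight_scale)
  moreover have "0 < q \<and> q \<le> 1 \<and> b \<in> A"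
    if "(q, b) \<in># (\<Sum>i\<in>I. scale (p i) (m i))" for q b
  proof -
    obtain i q' where i: "i \<in> I" "q = p i * q'" "(q', b) \<in># m i"
      using \<open>(q, b) \<in># _\<close> L3(1) by (auto simp: in_sum_mset scale_def)
    then show ?thesis
      using p[OF i(1)] m(2)[OF i(1,3)] by (auto intro: mult_le_one)
  qed
  ultimately show ?case
    using L3(2) by (auto simp: multidistributions_def)
qed

lemma nf_scale: "nf A R (scale q m) u = q * nf A R m u"
  unfolding nf_def scale_def
  by (induction m) (auto simp: algebra_simps)

lemma nf_sum: "finite I \<Longrightarrow> nf A R (\<Sum>i\<in>I. f i) u = (\<Sum>i\<in>I. nf A R (f i) u)"
  by (induction I rule: finite_induct) (auto simp: nf_def)

lemma nf_nonneg:
  assumes "m \<in> multidistributions A"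
  shows "0 \<le> nf A R m u"
proof -
  have "(\<forall>(p, a)\<in>#m. 0 < p) \<Longrightarrow> 0 \<le> nf A R m u"
    by (induction m) (auto simp: nf_def less_imp_le split: if_splits)
  with assms show ?thesis by (fastforce simp: multidistributions_def)
qed

lemma nf_image:
  "finite I \<Longrightarrow> nf A R {#(p i, a i). i \<in># mset_set I#} u = (\<Sum>i\<in>I. p i * nf A R {#(1, a i)#} u)"
  by (induction I rule: finite_induct) (auto simp: nf_def)

lemma mstep_nf_mono:
  assumes "pars A R" "mstep A R m n"
  shows "nf A R m \<le> nf A R n"
  using assms(2)
proof induction
  case (L1 a)
  then show ?case by simp
next
  case (L2 a \<beta>)
  then have "nf A R {#(1, a)#} u = 0" for u by (auto simp: nf_def NF_def)
  then show ?case
    using nf_nonneg[OF mdist_of_multidistribution[OF assms(1) L2]] by (simp add: le_fun_def)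
next
  case (L3 I p a m)
  have p: "0 \<le> p i" if "i \<in> I" for i
    using L3(1,2) that by (auto simp: multidistributions_def less_imp_le)
  show ?case
    using L3(1,4) p by (auto simp: le_fun_def nf_image nf_sum nf_scale intro!: sum_mono mult_left_mono)
qed

lemma sum_nf_le_1:
  assumes "m \<in> multidistributions A" "finite F"
  shows "sum (nf A R m) F \<le> 1"
proof -
  have "(\<forall>(p, a)\<in>#m. 0 < p) \<Longrightarrow> sum (nf A R m) F \<le> (\<Sum>(p, a)\<in>#m. p)"
  proof (induction m)
    case empty
    then show ?case by (auto simp: nf_def intro!: sum_nonpos)
  next
    case (add x m)
    have "nf A R (add_mset x m) u = nf A R m u + (if u = snd x then if u \<in> NF A R then fst x else 0 else 0)"
      for u by (auto simp: nf_def)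
    with add assms(2) show ?case
      by (cases x) (auto simp: sum.distrib sum.delta)
  qed
  with assms(1) show ?thesis by (fastforce simp: multidistributions_def)
qed

lemma seq_limit_LIMSEQ:
  assumes "pars A R" "mstep_sequence A R m s"
  shows "(\<lambda>n. nf A R (s n) u) \<longlonglongrightarrow> seq_limit A R s u"
  unfolding seq_limit_def
proof (rule LIMSEQ_incseq_SUP)
  have st: "mstep A R (s n) (s (Suc n))" for n
    using assms(2) by (simp add: mstep_sequence_def)
  show "bdd_above (range (\<lambda>n. nf A R (s n) u))"
    using mstep_multidistributions[OF assms(1) st] sum_nf_le_1[of _ A "{u}" R]
    by (intro bdd_aboveI[of _ 1]) auto
  show "incseq (\<lambda>n. nf A R (s n) u)"
    using mstep_nf_mono[OF assms(1) st] by (intro incseq_SucI) (simp add: le_fun_def)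
qed

lemma Lim_set_subdistribution:
  assumes "pars A R" "\<beta> \<in> Lim_set A R m"
  shows "subdistribution (NF A R) \<beta>"
proof -
  obtain s where s: "mstep_sequence A R m s" and \<beta>: "\<beta> = seq_limit A R s"
    using assms(2) by (auto simp: Lim_set_def)
  have lim: "(\<lambda>n. nf A R (s n) u) \<longlonglongrightarrow> \<beta> u" for u
    using seq_limit_LIMSEQ[OF assms(1) s] by (simp add: \<beta>)
  have md: "s n \<in> multidistributions A" for n
    using s mstep_multidistributions[OF assms(1)] by (auto simp: mstep_sequence_def)
  have nn: "0 \<le> \<beta> u" for u
    using nf_nonneg[OF md] by (intro LIMSEQ_le_const[OF lim]) auto
  have le: "sum \<beta> F \<le> 1" if "finite F" for F
    using sum_nf_le_1[OF md that]
    by (intro LIMSEQ_le_const2[OF tendsto_sum[OF lim]]) auto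
  have "\<beta> u \<le> 1" for u
    using le[of "{u}"] by simp
  moreover have "\<beta> u = 0" if "u \<notin> NF A R" for u
    using that by (simp add: \<beta> seq_limit_def nf_def)
  moreover have sm: "\<beta> summable_on NF A R"
    using nn le by (intro nonneg_bdd_above_summable_on bdd_aboveI[of _ 1]) auto
  moreover have "infsum \<beta> (NF A R) \<le> 1"
    using le by (intro infsum_le_finite_sums[OF sm]) auto
  ultimately show ?thesis
    using nn by (simp add: subdistribution_def)
qed

end

theory Submission
  imports Defs
begin

text \<open>Each of the three properties implies skew-confluence. Let \<open>\<beta> u\<close> be the supremum of
  \<open>nf r u\<close> over all reducts \<open>r\<close> of \<open>m\<close>; it bounds every element of \<open>Lim m\<close>. Since \<open>A\<close> is countable,
  countably many reducts \<open>r\<^sub>0, r\<^sub>1, \<dots>\<close> already realise all these suprema. Skew-confluence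
  yields reducts \<open>m = s\<^sub>0 \<Rightarrow>\<^sup>* s\<^sub>1 \<Rightarrow>\<^sup>* \<dots>\<close> with \<open>nf r\<^sub>n \<le> nf s\<^sub>n\<^sub>+\<^sub>1\<close>, and since the normal-form
  part never decreases, the sequence obtained by concatenation converges to \<open>\<beta>\<close>.\<close>

text \<open>Concatenates the finite paths behind the links \<open>f n\<close> to
  \<open>f (Suc n)\<close>. The closure is transitive but not reflexive, so no path is empty and the
  concatenation is infinite.\<close>

lemma tranclp_chain_refine:
  assumes chain: "\<And>n. r\<^sup>+\<^sup>+ (f n) (f (Suc n))"
  obtains g h where "g 0 = f 0" "\<And>n. r (g n) (g (Suc n))" "\<And>n :: nat. g (h n :: nat) = f n"
proof -
  have "\<exists>k p. 0 < k \<and> p 0 = f n \<and> p k = f (Suc n) \<and> (\<forall>i<k. r (p i) (p (Suc i)))" for n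
    using chain[of n] by (auto simp: tranclp_power relpowp_fun_conv)
  then obtain k p where kp: "\<And>n. 0 < k n" "\<And>n. p n 0 = f n" "\<And>n. p n (k n) = f (Suc n)"
      "\<And>n i. i < k n \<Longrightarrow> r (p n i) (p n (Suc i))"
    by metis
  \<comment> \<open>The pair \<open>(n, i)\<close> with \<open>i < k n\<close> is point
    \<open>i\<close> of path \<open>n\<close>. The endpoint \<open>p n (k n)\<close> gets no pair of
    its own: it equals \<open>p (Suc n) 0\<close>, which is where the paths are glued.\<close>
  define next_pos where
    "next_pos = (\<lambda>(n, i). if Suc i < k n then (n, Suc i) else (Suc n, 0 :: nat))"
  define pos where "pos j = (next_pos ^^ j) (0, 0)" for j
  define g where "g j = (case pos j of (n, i) \<Rightarrow> p n i)" for j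
  have pos_Suc: "pos (Suc j) = next_pos (pos j)" for j
    by (simp add: pos_def)
  have pos_bound: "snd (pos j) < k (fst (pos j))" for j
    by (induction j) (auto simp: pos_Suc next_pos_def kp(1) split: prod.splits, simp add: pos_def kp(1))
  have step: "r (g j) (g (Suc j))" for j
  proof -
    obtain n i where ni: "pos j = (n, i)" by fastforce
    with pos_bound[of j] have "i < k n" by simp
    then show ?thesis
      using kp(4)[of i n] kp(2)[of "Suc n"] kp(3)[of n]
      by (cases "Suc i = k n") (auto simp: g_def pos_Suc ni next_pos_def)
  qed
  have "\<exists>j. pos j = (n, 0)" for n
  proof (induction n)
    case 0
    show ?case by (rule exI[of _ 0]) (simp add: pos_def)
  next
    case (Suc n)
    then obtain j where j: "pos j = (n, 0)" by blast
    have "i < k n \<Longrightarrow> pos (j + i) = (n, i)" for i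
      by (induction i) (auto simp: j pos_Suc next_pos_def)
    from this[of "k n - 1"] have "pos (j + (k n - 1)) = (n, k n - 1)"
      using kp(1)[of n] by simp
    then have "pos (Suc (j + (k n - 1))) = (Suc n, 0)"
      using kp(1)[of n] unfolding pos_Suc next_pos_def by simp
    then show ?case by blast
  qed
  then obtain h where "\<And>n. pos (h n) = (n, 0)" by metis
  then have "g (h n) = f n" for n by (simp add: g_def kp(2))
  moreover have "g 0 = f 0" by (simp add: g_def pos_def kp(2))
  ultimately show thesis using step that by blast
qed

text \<open>Each element of \<open>A\<close> has a step as a point mass, by \<open>L1\<close> if it
  is a normal form and by \<open>L2\<close> otherwise; \<open>L3\<close> combines these steps. Hence
  finite reductions can always be prolonged.\<close>

lemma mstep_total:
  assumes "s \<in> multidistributions A"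
  shows "\<exists>t. mstep A R s t"
proof -
  obtain xs where xs: "mset xs = s" using ex_mset by blast
  let ?I = "{..<length xs}"
  have s: "{#(fst (xs ! i), snd (xs ! i)). i \<in># mset_set ?I#} = s"
    by (simp add: lessThan_atLeast0 flip: mset_upt mset_map xs) (simp add: map_nth)
  have "\<exists>t. mstep A R {#(1, snd (xs ! i))#} t" if "i \<in> ?I" for i
  proof -
    have "xs ! i \<in># s" using that xs by auto
    then have "snd (xs ! i) \<in> A" using assms by (auto simp: multidistributions_def)
    then show ?thesis
      by (cases "snd (xs ! i) \<in> NF A R") (blast intro: L1, auto simp: NF_def intro: L2)
  qed
  then obtain t where "\<And>i. i \<in> ?I \<Longrightarrow> mstep A R {#(1, snd (xs ! i))#} (t i)" by metis
  then show ?thesis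
    using L3[of ?I "\<lambda>i. fst (xs ! i)" "\<lambda>i. snd (xs ! i)" A R t] assms unfolding s by blast
qed

lemma msteps_multidistributions:
  assumes "pars A R" "msteps A R m s" "m \<in> multidistributions A"
  shows "s \<in> multidistributions A"
  using assms(2,3) by induction (use mstep_multidistributions[OF assms(1)] in blast)+

lemma msteps_nf_mono:
  assumes "pars A R" "msteps A R m s"
  shows "nf A R m \<le> nf A R s"
  using assms(2) by induction (use mstep_nf_mono[OF assms(1)] in \<open>auto intro: order_trans\<close>)

lemma mstep_sequence_msteps:
  assumes "mstep_sequence A R m s"
  shows "msteps A R m (s n)"
  using assms by (induction n) (auto simp: mstep_sequence_def intro: rtranclp.rtrancl_into_rtrancl)

text \<open>Monotonicity gives nf r \<le> nf r' = nf s'.\<close>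

lemma nf_confluent_imp_skew_confluent:
  assumes "pars A R" "nf_confluent A R"
  shows "skew_confluent A R"
  using assms(2) msteps_nf_mono[OF assms(1)] unfolding nf_confluent_def skew_confluent_def by metis

lemma confluent_imp_nf_confluent: "confluent A R \<Longrightarrow> nf_confluent A R"
  unfolding confluent_def nf_confluent_def by blast

lemma nf_le_1: "s \<in> multidistributions A \<Longrightarrow> nf A R s u \<le> 1"
  using sum_nf_le_1[of s A "{u}" R] by simp

text \<open>The supremum over all reducts need not be attained, hence the slack \<open>e\<close>:
  for each normal form \<open>u\<close> and each \<open>k\<close>, one picks a reduct within 1/(k+1)
  of the supremum at \<open>u\<close>.\<close>

lemma countable_nf_approximation:
  assumes "pars A R" "m \<in> multidistributions A"
  obtains r where "\<And>n :: nat. msteps A R m (r n)"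
    and "\<And>s u e. \<lbrakk>msteps A R m s; u \<in> NF A R; 0 < e\<rbrakk> \<Longrightarrow> \<exists>n. nf A R s u < nf A R (r n) u + e"
proof -
  let ?S = "{s. msteps A R m s}"
  define \<beta> where "\<beta> u = (SUP s\<in>?S. nf A R s u)" for u
  have bdd: "bdd_above ((\<lambda>s. nf A R s u) ` ?S)" for u
    using msteps_multidistributions[OF assms(1) _ assms(2)]
    by (intro bdd_aboveI[of _ 1]) (auto intro: nf_le_1)
  have "\<exists>s\<in>?S. \<beta> u - inverse (Suc k) < nf A R s u" for u k
    using less_cSUP_iff[OF _ bdd, of "\<beta> u - inverse (Suc k)" u] by (auto simp: \<beta>_def)
  then obtain q where q: "\<And>u k. msteps A R m (q u k)"
      "\<And>u k. \<beta> u - inverse (Suc k) < nf A R (q u k) u"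
    by simp metis
  have cnt: "countable (NF A R \<times> (UNIV :: nat set))"
    using assms(1) by (auto simp: pars_def NF_def intro: countable_subset)
  \<comment> \<open>Without normal forms the enumerated set is empty and the pair is arbitrary;
    \<open>r n\<close> is still a reduct, because \<open>q u k\<close> is one for every
    \<open>u\<close>.\<close>
  define r where "r n = case_prod q (from_nat_into (NF A R \<times> UNIV) n)" for n
  have "msteps A R m (r n)" for n
    by (simp add: r_def q(1) split: prod.split)
  moreover have "\<exists>n. nf A R s u < nf A R (r n) u + e"
    if s: "msteps A R m s" and u: "u \<in> NF A R" and "0 < e" for s u e
  proof -
    obtain k where k: "inverse (real (Suc k)) < e"
      using reals_Archimedean[OF \<open>0 < e\<close>] by blast
    obtain n where "from_nat_into (NF A R \<times> UNIV) n = (u, k)"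
      using from_nat_into_surj[OF cnt, of "(u, k)"] u by auto
    then have "r n = q u k" by (simp add: r_def)
    moreover have "nf A R s u \<le> \<beta> u"
      using s by (auto simp: \<beta>_def intro: cSUP_upper[OF _ bdd])
    ultimately show ?thesis using q(2)[of u k] k by (intro exI[of _ n]) auto
  qed
  ultimately show thesis using that by blast
qed

lemma skew_confluent_dominating_sequence:
  assumes "pars A R" "skew_confluent A R" "m \<in> multidistributions A"
    and r: "\<And>n :: nat. msteps A R m (r n)"
  obtains s h where "mstep_sequence A R m s" "\<And>n. nf A R (r n) \<le> nf A R (s (h n))"
proof -
  note md = msteps_multidistributions[OF assms(1) _ assms(3)]
  \<comment> \<open>The conjunct for \<open>n = 0\<close> pins the chain to start at
    \<open>m\<close>; being a reduct of \<open>m\<close> is the invariant that lets skew-confluence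
    apply again.\<close>
  have "\<exists>f. \<forall>n. (msteps A R m (f n) \<and> (n = 0 \<longrightarrow> f n = m)) \<and>
      (mstep A R)\<^sup>+\<^sup>+ (f n) (f (Suc n)) \<and> nf A R (r n) \<le> nf A R (f (Suc n))"
  proof (rule dependent_nat_choice)
    fix x and n :: nat
    assume x: "msteps A R m x \<and> (n = 0 \<longrightarrow> x = m)"
    then obtain y where y: "y \<in> multidistributions A" "msteps A R x y" "nf A R (r n) \<le> nf A R y"
      using assms(2,3) md r unfolding skew_confluent_def by metis
    \<comment> \<open>Skew-confluence may return \<open>x\<close> itself; one further step makes the
      link nonempty, and monotonicity keeps the bound.\<close>
    obtain z where z: "mstep A R y z" using mstep_total[OF y(1)] by blast
    have "(mstep A R)\<^sup>+\<^sup>+ x z" using y(2) z by (rule rtranclp_into_tranclp1)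
    moreover from this have "msteps A R m z" using x by (auto dest: tranclp_into_rtranclp)
    moreover have "nf A R (r n) \<le> nf A R z"
      using y(3) mstep_nf_mono[OF assms(1) z] by (rule order_trans)
    ultimately show "\<exists>y. (msteps A R m y \<and> (Suc n = 0 \<longrightarrow> y = m)) \<and>
        (mstep A R)\<^sup>+\<^sup>+ x y \<and> nf A R (r n) \<le> nf A R y"
      by blast
  qed auto
  then obtain f where f: "f 0 = m" "\<And>n. (mstep A R)\<^sup>+\<^sup>+ (f n) (f (Suc n))"
      "\<And>n. nf A R (r n) \<le> nf A R (f (Suc n))"
    by blast
  obtain s h where s: "s 0 = f 0" "\<And>n. mstep A R (s n) (s (Suc n))" "\<And>n. s (h n) = f n"
    using tranclp_chain_refine[of "mstep A R" f, OF f(2)] by blast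
  show thesis
  proof (rule that)
    show "mstep_sequence A R m s" using s f(1) by (simp add: mstep_sequence_def)
    show "nf A R (r n) \<le> nf A R (s (h (Suc n)))" for n using f(3) by (simp add: s(3))
  qed
qed

theorem mainTheorem1:
  fixes A :: "'a set" and R :: "('a \<times> ('a \<Rightarrow> real)) set" and m :: "'a mdist"
  assumes "pars A R"
    and "confluent A R \<or> nf_confluent A R \<or> skew_confluent A R"
    and "m \<in> multidistributions A"
  shows "\<exists>\<beta>\<in>Lim_set A R m. \<forall>\<gamma>\<in>Lim_set A R m. \<gamma> \<le> \<beta>"
proof -
  have skew: "skew_confluent A R"
    using assms(1,2) confluent_imp_nf_confluent nf_confluent_imp_skew_confluent by blast
  obtain r where r: "\<And>n :: nat. msteps A R m (r n)"
      "\<And>s u e. \<lbrakk>msteps A R m s; u \<in> NF A R; 0 < e\<rbrakk> \<Longrightarrow> \<exists>n. nf A R s u < nf A R (r n) u + e"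
    using countable_nf_approximation[OF assms(1,3)] by blast
  obtain s h where s: "mstep_sequence A R m s" and dom: "\<And>n. nf A R (r n) \<le> nf A R (s (h n))"
    using skew_confluent_dominating_sequence[OF assms(1) skew assms(3), of r, OF r(1)] by blast
  note md = msteps_multidistributions[OF assms(1) mstep_sequence_msteps[OF s] assms(3)]
  have upper: "nf A R (s n) u \<le> seq_limit A R s u" for n u
    unfolding seq_limit_def using nf_le_1[OF md] by (intro cSUP_upper bdd_aboveI[of _ 1]) auto
  \<comment> \<open>The bound holds for all reducts, so it passes to the limit of any competing
    sequence, whose terms are reducts of \<open>m\<close>.\<close>
  have reduct_le: "nf A R t u \<le> seq_limit A R s u" if t: "msteps A R m t" for t u
  proof (cases "u \<in> NF A R")
    case False
    then show ?thesis by (simp add: nf_def seq_limit_def)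
  next
    case True
    show ?thesis
    proof (rule field_le_epsilon)
      fix e :: real assume "0 < e"
      then obtain n where "nf A R t u < nf A R (r n) u + e" using r(2)[OF t True] by blast
      also have "nf A R (r n) u \<le> nf A R (s (h n)) u" using dom by (simp add: le_fun_def)
      also have "\<dots> \<le> seq_limit A R s u" by (rule upper)
      finally show "nf A R t u \<le> seq_limit A R s u + e" by simp
    qed
  qed
  show ?thesis
  proof (intro bexI ballI)
    show "seq_limit A R s \<in> Lim_set A R m" using s by (auto simp: Lim_set_def)
    fix \<gamma> assume "\<gamma> \<in> Lim_set A R m"
    then obtain t where t: "mstep_sequence A R m t" "\<gamma> = seq_limit A R t"
      by (auto simp: Lim_set_def)
    have "(SUP n. nf A R (t n) u) \<le> seq_limit A R s u" for u
      using mstep_sequence_msteps[OF t(1)] by (intro cSUP_least reduct_le) auto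
    then show "\<gamma> \<le> seq_limit A R s" by (simp add: le_fun_def t(2) seq_limit_def[of A R t])
  qed
qed

end
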